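(* Let $V$ be an infinite-dimensional vector space over a division ring. Then the lattice of all subspaces of $V$ (ordered by inclusion) has no lattice embedding into any $\aleph_0$-complete, $\aleph_0$-upper continuous, and $\aleph_0$-lower continuous lattice.
   Context: A lattice is $\aleph_0$-complete if every at most countable subset has a join and a meet. A lattice $L$ is $\aleph_0$-lower continuous if $a\vee\bigwedge X=\bigwedge\{a\vee x\mid x\in X\}$ for every $a\in L$ and every at most countable downward directed $X\subseteq L$ such that $\bigwedge X$ exists; $\aleph_0$-upper continuity is the dual notion. A lattice embedding is an injective map preserving binary joins and meets. *)

theory Defs
  imports
    "HOL-Algebra.Module"
    "HOL-Algebra.AbelCoset"
    "HOL-Algebra.Lattice"
    "HOL-Library.Countable_Set"
begin

section \<open>Vector spaces over a division ring\<close>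

locale division_ring = ring R for R (structure) +
  assumes one_not_zero: "\<one> \<noteq> \<zero>"
    and division_ring_Units: "Units R = carrier R - {\<zero>}"

text \<open>The axioms of the locale \<^locale>\<open>module\<close>, which presupposes commutative scalars, over a
  division ring. Right vector spaces are covered by passing to the opposite division ring.\<close>

locale left_vector_space = R?: division_ring R + V?: abelian_group V
  for R (structure) and V (structure) +
  assumes smult_closed:
      "\<lbrakk>a \<in> carrier R; x \<in> carrier V\<rbrakk> \<Longrightarrow> a \<odot>\<^bsub>V\<^esub> x \<in> carrier V"
    and smult_l_distr:
      "\<lbrakk>a \<in> carrier R; b \<in> carrier R; x \<in> carrier V\<rbrakk> \<Longrightarrow>
        (a \<oplus> b) \<odot>\<^bsub>V\<^esub> x = a \<odot>\<^bsub>V\<^esub> x \<oplus>\<^bsub>V\<^esub> b \<odot>\<^bsub>V\<^esub> x"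
    and smult_r_distr:
      "\<lbrakk>a \<in> carrier R; x \<in> carrier V; y \<in> carrier V\<rbrakk> \<Longrightarrow>
        a \<odot>\<^bsub>V\<^esub> (x \<oplus>\<^bsub>V\<^esub> y) = a \<odot>\<^bsub>V\<^esub> x \<oplus>\<^bsub>V\<^esub> a \<odot>\<^bsub>V\<^esub> y"
    and smult_assoc1:
      "\<lbrakk>a \<in> carrier R; b \<in> carrier R; x \<in> carrier V\<rbrakk> \<Longrightarrow>
        (a \<otimes> b) \<odot>\<^bsub>V\<^esub> x = a \<odot>\<^bsub>V\<^esub> (b \<odot>\<^bsub>V\<^esub> x)"
    and smult_one: "x \<in> carrier V \<Longrightarrow> \<one> \<odot>\<^bsub>V\<^esub> x = x"

definition lin_span :: "('a, 'r) ring_scheme \<Rightarrow> ('a, 'v, 'm) module_scheme \<Rightarrow> 'v set \<Rightarrow> 'v set"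
  where "lin_span R V S =
    {finsum V (\<lambda>v. c v \<odot>\<^bsub>V\<^esub> v) A | A c. finite A \<and> A \<subseteq> S \<and> c \<in> A \<rightarrow> carrier R}"

definition lin_indep :: "('a, 'r) ring_scheme \<Rightarrow> ('a, 'v, 'm) module_scheme \<Rightarrow> 'v set \<Rightarrow> bool"
  where "lin_indep R V S \<longleftrightarrow>
    (\<forall>A c. finite A \<and> A \<subseteq> S \<and> c \<in> A \<rightarrow> carrier R \<and>
       finsum V (\<lambda>v. c v \<odot>\<^bsub>V\<^esub> v) A = \<zero>\<^bsub>V\<^esub> \<longrightarrow> (\<forall>v\<in>A. c v = \<zero>\<^bsub>R\<^esub>))"

definition is_basis :: "('a, 'r) ring_scheme \<Rightarrow> ('a, 'v, 'm) module_scheme \<Rightarrow> 'v set \<Rightarrow> bool"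
  where "is_basis R V B \<longleftrightarrow> B \<subseteq> carrier V \<and> lin_indep R V B \<and> lin_span R V B = carrier V"

definition infinite_dimensional :: "('a, 'r) ring_scheme \<Rightarrow> ('a, 'v, 'm) module_scheme \<Rightarrow> bool"
  where "infinite_dimensional R V \<longleftrightarrow> \<not> (\<exists>B. finite B \<and> is_basis R V B)"


section \<open>The lattice of subspaces\<close>

definition subspace_lattice ::
    "('a, 'r) ring_scheme \<Rightarrow> ('a, 'v, 'm) module_scheme \<Rightarrow> 'v set gorder"
  where "subspace_lattice R V =
    \<lparr>carrier = {W. submodule W R V}, eq = (=), le = (\<subseteq>)\<rparr>"

context left_vector_space
begin

lemma submodule_iff:
  "submodule W R V \<longleftrightarrow> W \<subseteq> carrier V \<and> \<zero>\<^bsub>V\<^esub> \<in> W \<and> (\<forall>x\<in>W. \<forall>y\<in>W. x \<oplus>\<^bsub>V\<^esub> y \<in> W)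
     \<and> (\<forall>x\<in>W. \<ominus>\<^bsub>V\<^esub> x \<in> W) \<and> (\<forall>a\<in>carrier R. \<forall>x\<in>W. a \<odot>\<^bsub>V\<^esub> x \<in> W)"
  unfolding submodule_def submodule_axioms_def subgroup_def
  by (auto simp: a_inv_def)

lemma subspace_Int:
  assumes "submodule A R V" "submodule B R V"
  shows "submodule (A \<inter> B) R V"
  using assms unfolding submodule_iff by blast

lemma subspace_add:
  assumes "submodule A R V" "submodule B R V"
  shows "submodule (A <+>\<^bsub>V\<^esub> B) R V"
proof -
  have A: "A \<subseteq> carrier V" "\<zero>\<^bsub>V\<^esub> \<in> A" "\<And>x y. x \<in> A \<Longrightarrow> y \<in> A \<Longrightarrow> x \<oplus>\<^bsub>V\<^esub> y \<in> A"
      "\<And>x. x \<in> A \<Longrightarrow> \<ominus>\<^bsub>V\<^esub> x \<in> A" "\<And>a x. a \<in> carrier R \<Longrightarrow> x \<in> A \<Longrightarrow> a \<odot>\<^bsub>V\<^esub> x \<in> A"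
    and B: "B \<subseteq> carrier V" "\<zero>\<^bsub>V\<^esub> \<in> B" "\<And>x y. x \<in> B \<Longrightarrow> y \<in> B \<Longrightarrow> x \<oplus>\<^bsub>V\<^esub> y \<in> B"
      "\<And>x. x \<in> B \<Longrightarrow> \<ominus>\<^bsub>V\<^esub> x \<in> B" "\<And>a x. a \<in> carrier R \<Longrightarrow> x \<in> B \<Longrightarrow> a \<odot>\<^bsub>V\<^esub> x \<in> B"
    using assms unfolding submodule_iff by blast+
  have mem: "z \<in> A <+>\<^bsub>V\<^esub> B \<longleftrightarrow> (\<exists>x\<in>A. \<exists>y\<in>B. z = x \<oplus>\<^bsub>V\<^esub> y)" for z
    by (simp add: set_add_def')
  show ?thesis
    unfolding submodule_iff
  proof (intro conjI ballI)
    show "A <+>\<^bsub>V\<^esub> B \<subseteq> carrier V"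
      proof
      fix z assume "z \<in> A <+>\<^bsub>V\<^esub> B"
      then obtain x y where "x \<in> A" "y \<in> B" "z = x \<oplus>\<^bsub>V\<^esub> y"
        unfolding mem by blast
      then show "z \<in> carrier V"
        using A(1) B(1) by (simp add: subset_iff)
    qed
    show "\<zero>\<^bsub>V\<^esub> \<in> A <+>\<^bsub>V\<^esub> B"
      using A(2) B(2) unfolding mem by (metis V.l_zero V.zero_closed)
  next
    fix x y assume "x \<in> A <+>\<^bsub>V\<^esub> B" "y \<in> A <+>\<^bsub>V\<^esub> B"
    then obtain a b a' b' where h: "a \<in> A" "b \<in> B" "a' \<in> A" "b' \<in> B"
      and e: "x = a \<oplus>\<^bsub>V\<^esub> b" "y = a' \<oplus>\<^bsub>V\<^esub> b'"
      unfolding mem by blast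
    have "a \<in> carrier V" "b \<in> carrier V" "a' \<in> carrier V" "b' \<in> carrier V"
      using h A(1) B(1) by auto
    then have "x \<oplus>\<^bsub>V\<^esub> y = (a \<oplus>\<^bsub>V\<^esub> a') \<oplus>\<^bsub>V\<^esub> (b \<oplus>\<^bsub>V\<^esub> b')"
      unfolding e by (simp add: V.a_ac)
    then show "x \<oplus>\<^bsub>V\<^esub> y \<in> A <+>\<^bsub>V\<^esub> B"
      using A(3) B(3) h unfolding mem by blast
  next
    fix x assume "x \<in> A <+>\<^bsub>V\<^esub> B"
    then obtain a b where h: "a \<in> A" "b \<in> B" and e: "x = a \<oplus>\<^bsub>V\<^esub> b"
      unfolding mem by blast
    have "a \<in> carrier V" "b \<in> carrier V"
      using h A(1) B(1) by auto
    then have "\<ominus>\<^bsub>V\<^esub> x = \<ominus>\<^bsub>V\<^esub> a \<oplus>\<^bsub>V\<^esub> \<ominus>\<^bsub>V\<^esub> b"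
      unfolding e by (simp add: V.minus_add)
    then show "\<ominus>\<^bsub>V\<^esub> x \<in> A <+>\<^bsub>V\<^esub> B"
      using A(4) B(4) h unfolding mem by blast
  next
    fix c x assume c: "c \<in> carrier R" and "x \<in> A <+>\<^bsub>V\<^esub> B"
    then obtain a b where h: "a \<in> A" "b \<in> B" and e: "x = a \<oplus>\<^bsub>V\<^esub> b"
      unfolding mem by blast
    have "a \<in> carrier V" "b \<in> carrier V"
      using h A(1) B(1) by auto
    then have "c \<odot>\<^bsub>V\<^esub> x = c \<odot>\<^bsub>V\<^esub> a \<oplus>\<^bsub>V\<^esub> c \<odot>\<^bsub>V\<^esub> b"
      unfolding e by (rule smult_r_distr[OF c])
    then show "c \<odot>\<^bsub>V\<^esub> x \<in> A <+>\<^bsub>V\<^esub> B"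
      using A(5) B(5) c h unfolding mem by blast
  qed
qed

lemma least_subspace_add:
  assumes "submodule A R V" "submodule B R V"
  shows "least (subspace_lattice R V) (A <+>\<^bsub>V\<^esub> B) (Upper (subspace_lattice R V) {A, B})"
proof -
  have sub: "A \<subseteq> carrier V" "B \<subseteq> carrier V" and z: "\<zero>\<^bsub>V\<^esub> \<in> A" "\<zero>\<^bsub>V\<^esub> \<in> B"
    using assms unfolding submodule_iff by blast+
  have mem: "z \<in> A <+>\<^bsub>V\<^esub> B \<longleftrightarrow> (\<exists>x\<in>A. \<exists>y\<in>B. z = x \<oplus>\<^bsub>V\<^esub> y)" for z
    by (simp add: set_add_def')
  have "A \<subseteq> A <+>\<^bsub>V\<^esub> B"
  proof
    fix x assume "x \<in> A"
    moreover from this have "x = x \<oplus>\<^bsub>V\<^esub> \<zero>\<^bsub>V\<^esub>" using sub by auto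
    ultimately show "x \<in> A <+>\<^bsub>V\<^esub> B" using z unfolding mem by blast
  qed
  moreover have "B \<subseteq> A <+>\<^bsub>V\<^esub> B"
  proof
    fix x assume "x \<in> B"
    moreover from this have "x = \<zero>\<^bsub>V\<^esub> \<oplus>\<^bsub>V\<^esub> x" using sub by auto
    ultimately show "x \<in> A <+>\<^bsub>V\<^esub> B" using z unfolding mem by blast
  qed
  moreover have "A <+>\<^bsub>V\<^esub> B \<subseteq> W" if "submodule W R V" "A \<subseteq> W" "B \<subseteq> W" for W
    proof
    fix z assume "z \<in> A <+>\<^bsub>V\<^esub> B"
    then obtain x y where "x \<in> A" "y \<in> B" "z = x \<oplus>\<^bsub>V\<^esub> y"
      unfolding mem by blast
    then show "z \<in> W"
      using that unfolding submodule_iff by blast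
  qed
  ultimately show ?thesis
    using assms subspace_add[OF assms]
    by (auto simp: least_def Upper_def subspace_lattice_def)
qed

lemma greatest_subspace_Int:
  assumes "submodule A R V" "submodule B R V"
  shows "greatest (subspace_lattice R V) (A \<inter> B) (Lower (subspace_lattice R V) {A, B})"
  using assms subspace_Int[OF assms]
  by (auto simp: greatest_def Lower_def subspace_lattice_def)

lemma subspace_lattice: "lattice (subspace_lattice R V)"
proof -
  interpret partial_order "subspace_lattice R V"
    by unfold_locales (auto simp: subspace_lattice_def)
  show ?thesis
  proof
    fix A B assume "A \<in> carrier (subspace_lattice R V)" "B \<in> carrier (subspace_lattice R V)"
    then have AB: "submodule A R V" "submodule B R V"
      by (auto simp: subspace_lattice_def)
    show "\<exists>s. least (subspace_lattice R V) s (Upper (subspace_lattice R V) {A, B})"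
      using least_subspace_add[OF AB] ..
    show "\<exists>s. greatest (subspace_lattice R V) s (Lower (subspace_lattice R V) {A, B})"
      using greatest_subspace_Int[OF AB] ..
  qed
qed

end


section \<open>Countable completeness and continuity\<close>

text \<open>The constants \<^const>\<open>sup\<close> and \<^const>\<open>inf\<close> are underspecified on sets without a supremum or
  infimum, so infinite joins and meets are expressed with \<^const>\<open>least\<close> and \<^const>\<open>greatest\<close>. In
  particular, the continuity conditions assert that the join or meet on the right exists.\<close>

definition aleph0_complete :: "('l, 'm) gorder_scheme \<Rightarrow> bool"
  where "aleph0_complete L \<longleftrightarrow>
    (\<forall>X. X \<subseteq> carrier L \<and> countable X \<longrightarrow>
      (\<exists>s. least L s (Upper L X)) \<and> (\<exists>m. greatest L m (Lower L X)))"

definition downward_directed :: "('l, 'm) gorder_scheme \<Rightarrow> 'l set \<Rightarrow> bool"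
  where "downward_directed L X \<longleftrightarrow>
    X \<noteq> {} \<and> (\<forall>x\<in>X. \<forall>y\<in>X. \<exists>z\<in>X. z \<sqsubseteq>\<^bsub>L\<^esub> x \<and> z \<sqsubseteq>\<^bsub>L\<^esub> y)"

definition upward_directed :: "('l, 'm) gorder_scheme \<Rightarrow> 'l set \<Rightarrow> bool"
  where "upward_directed L X \<longleftrightarrow>
    X \<noteq> {} \<and> (\<forall>x\<in>X. \<forall>y\<in>X. \<exists>z\<in>X. x \<sqsubseteq>\<^bsub>L\<^esub> z \<and> y \<sqsubseteq>\<^bsub>L\<^esub> z)"

definition aleph0_lower_continuous :: "('l, 'm) gorder_scheme \<Rightarrow> bool"
  where "aleph0_lower_continuous L \<longleftrightarrow>
    (\<forall>a\<in>carrier L. \<forall>X m. X \<subseteq> carrier L \<and> countable X \<and> downward_directed L X \<and>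
       greatest L m (Lower L X) \<longrightarrow>
       greatest L (a \<squnion>\<^bsub>L\<^esub> m) (Lower L ((\<lambda>x. a \<squnion>\<^bsub>L\<^esub> x) ` X)))"

definition aleph0_upper_continuous :: "('l, 'm) gorder_scheme \<Rightarrow> bool"
  where "aleph0_upper_continuous L \<longleftrightarrow>
    (\<forall>a\<in>carrier L. \<forall>X s. X \<subseteq> carrier L \<and> countable X \<and> upward_directed L X \<and>
       least L s (Upper L X) \<longrightarrow>
       least L (a \<sqinter>\<^bsub>L\<^esub> s) (Upper L ((\<lambda>x. a \<sqinter>\<^bsub>L\<^esub> x) ` X)))"


section \<open>Lattice embeddings\<close>

definition lattice_embedding ::
    "('k, 'm) gorder_scheme \<Rightarrow> ('l, 'n) gorder_scheme \<Rightarrow> ('k \<Rightarrow> 'l) \<Rightarrow> bool"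
  where "lattice_embedding K L f \<longleftrightarrow>
    f \<in> carrier K \<rightarrow> carrier L \<and> inj_on f (carrier K) \<and> join_pres K L f \<and> meet_pres K L f"

end

theory Submission
  imports Defs
begin

text \<open>Let \<open>e\<^sub>0, e\<^sub>1, \<dots>\<close> be linearly independent in \<open>V\<close>, let \<open>f\<close> be an embedding, and let
  \<open>z = f 0\<close>. Put \<open>A\<^sub>n = \<Squnion>\<^sub>k f \<langle>e\<^sub>n, \<dots>, e\<^sub>n\<^sub>+\<^sub>k\<rangle>\<close> and \<open>m = \<Sqinter>\<^sub>n A\<^sub>n\<close>. By upper continuity,
  \<open>A\<^sub>n\<close> meets \<open>f \<langle>e\<^sub>0, \<dots>, e\<^sub>n\<^sub>-\<^sub>1\<rangle>\<close> in \<open>z\<close>; hence so does \<open>m\<close>, for every \<open>n\<close>, and upper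
  continuity again gives \<open>m = m \<sqinter> A\<^sub>0 = z\<close>. Let \<open>c\<close> be the join of the images of the spans of
  \<open>e\<^sub>0 - e\<^sub>1, \<dots>, e\<^sub>n\<^sub>-\<^sub>1 - e\<^sub>n\<close>. Then \<open>f \<langle>e\<^sub>0\<rangle> \<le> c \<squnion> A\<^sub>n\<close> for all \<open>n\<close>, so
  \<open>f \<langle>e\<^sub>0\<rangle> \<le> c \<squnion> m = c\<close> by lower continuity. But each of these spans meets \<open>\<langle>e\<^sub>0\<rangle>\<close>
  trivially, so upper continuity forces \<open>f \<langle>e\<^sub>0\<rangle> = f \<langle>e\<^sub>0\<rangle> \<sqinter> c = z\<close>.\<close>

section \<open>Countable chains in a continuous lattice\<close>

context lattice
begin

text \<open>The range of an increasing sequence is countable and directed, so upper continuity makes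
  \<open>x \<sqinter> s\<close> the least upper bound of the meets \<open>x \<sqinter> g n\<close>,
  and \<open>z\<close> is another upper bound of them.\<close>

lemma aleph0_upper_continuous_chain:
  fixes g :: "nat \<Rightarrow> 'a"
  assumes "aleph0_upper_continuous L"
    and g: "\<And>n. g n \<in> carrier L" "\<And>n. g n \<sqsubseteq> g (Suc n)"
    and s: "least L s (Upper L (range g))"
    and x: "x \<in> carrier L" and z: "z \<in> carrier L" "\<And>n. x \<sqinter> g n \<sqsubseteq> z"
  shows "x \<sqinter> s \<sqsubseteq> z"
proof -
  have mono: "g m \<sqsubseteq> g n" if "m \<le> n" for m n
    using that
  proof (induction rule: dec_induct)
    case (step n)
    show ?case
      by (rule le_trans[OF step.IH g(2)]) (simp_all add: g(1))
  qed (simp add: g(1))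
  have "g i \<sqsubseteq> g (max i j) \<and> g j \<sqsubseteq> g (max i j)" for i j
    by (simp add: mono)
  then have "upward_directed L (range g)"
    unfolding upward_directed_def by blast
  then have "least L (x \<sqinter> s) (Upper L ((\<lambda>y. x \<sqinter> y) ` range g))"
    using assms(1) g(1) s x unfolding aleph0_upper_continuous_def
    by (metis countableI_type countable_image image_subsetI)
  moreover have "z \<in> Upper L ((\<lambda>y. x \<sqinter> y) ` range g)"
    using z by (auto simp: Upper_def)
  ultimately show ?thesis
    by (rule least_le)
qed

lemma aleph0_lower_continuous_chain:
  fixes g :: "nat \<Rightarrow> 'a"
  assumes "aleph0_lower_continuous L"
    and g: "\<And>n. g n \<in> carrier L" "\<And>n. g (Suc n) \<sqsubseteq> g n"
    and m: "greatest L m (Lower L (range g))"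
    and x: "x \<in> carrier L" and z: "z \<in> carrier L" "\<And>n. z \<sqsubseteq> x \<squnion> g n"
  shows "z \<sqsubseteq> x \<squnion> m"
proof -
  have mono: "g n \<sqsubseteq> g m" if "m \<le> n" for m n
    using that
  proof (induction rule: dec_induct)
    case (step n)
    show ?case
      by (rule le_trans[OF g(2) step.IH]) (simp_all add: g(1))
  qed (simp add: g(1))
  have "g (max i j) \<sqsubseteq> g i \<and> g (max i j) \<sqsubseteq> g j" for i j
    by (simp add: mono)
  then have "downward_directed L (range g)"
    unfolding downward_directed_def by blast
  then have "greatest L (x \<squnion> m) (Lower L ((\<lambda>y. x \<squnion> y) ` range g))"
    using assms(1) g(1) m x unfolding aleph0_lower_continuous_def
    by (metis countableI_type countable_image image_subsetI)
  moreover have "z \<in> Lower L ((\<lambda>y. x \<squnion> y) ` range g)"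
    using z by (auto simp: Lower_def)
  ultimately show ?thesis
    by (rule greatest_le)
qed

text \<open>The lattice-theoretic core, free of vector spaces. In the application
  \<open>F n k\<close> is the image of the span of the \<open>k\<close> vectors from
  \<open>e n\<close> on, \<open>C n\<close> that of the first \<open>n\<close> differences,
  \<open>a\<close> that of the line of \<open>e 0\<close>, and \<open>z\<close> that of the zero
  subspace. \<open>z\<close> need not be the bottom of \<open>L\<close>; only the inequalities
  listed are used of it.\<close>

lemma le_bottom_if_perspective_tails:
  fixes F :: "nat \<Rightarrow> nat \<Rightarrow> 'a" and C :: "nat \<Rightarrow> 'a"
  assumes comp: "aleph0_complete L"
    and up: "aleph0_upper_continuous L"
    and low: "aleph0_lower_continuous L"
    and carr: "\<And>n k. F n k \<in> carrier L" "\<And>n. C n \<in> carrier L"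
      "a \<in> carrier L" "z \<in> carrier L"
    and F_mono: "\<And>n k. F n k \<sqsubseteq> F n (Suc k)"
    and F_shift: "\<And>n k. F (Suc n) k \<sqsubseteq> F n (Suc k)"
    and F_meet: "\<And>n k. F 0 n \<sqinter> F n k \<sqsubseteq> z"
    and C_mono: "\<And>n. C n \<sqsubseteq> C (Suc n)"
    and C_meet: "\<And>n. a \<sqinter> C n \<sqsubseteq> z"
    and z_le: "\<And>n. z \<sqsubseteq> C n"
    and a_le: "\<And>n. a \<sqsubseteq> C n \<squnion> F n 1"
  shows "a \<sqsubseteq> z"
proof -
  have ex: "\<exists>s. least L s (Upper L X)" "\<exists>m. greatest L m (Lower L X)"
    if "X \<subseteq> carrier L" "countable X" for X
    using comp that unfolding aleph0_complete_def by blast+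
  have "\<exists>s. least L s (Upper L (range (F n)))" for n
    by (rule ex) (use carr in auto)
  then obtain A where A: "\<And>n. least L (A n) (Upper L (range (F n)))"
    by metis
  have Ac: "A n \<in> carrier L" and F_le_A: "F n k \<sqsubseteq> A n" for n k
    using A[of n] carr by (auto simp: least_def Upper_def)
  have A_le: "A n \<sqsubseteq> y" if "y \<in> carrier L" "\<And>k. F n k \<sqsubseteq> y" for n y
    using A[of n] that by (auto simp: least_def Upper_def)
  \<comment> \<open>By \<open>F_shift\<close>, each span in the tail from \<open>Suc n\<close> lies
    in a span of the tail from \<open>n\<close> with one vector more.\<close>
  have A_dec: "A (Suc n) \<sqsubseteq> A n" for n
    by (rule A_le[OF Ac le_trans[OF F_shift F_le_A]]) (use Ac carr in auto)
  obtain m where m: "greatest L m (Lower L (range A))"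
    using ex(2)[of "range A"] Ac by (auto simp: image_subset_iff)
  have mc: "m \<in> carrier L" and m_le: "m \<sqsubseteq> A n" for n
    using m Ac by (auto simp: greatest_def Lower_def)
  obtain c where c: "least L c (Upper L (range C))"
    using ex(1)[of "range C"] carr by (auto simp: image_subset_iff)
  have cc: "c \<in> carrier L" and C_le: "C n \<sqsubseteq> c" for n
    using c carr by (auto simp: least_def Upper_def)
  \<comment> \<open>The head \<open>F 0 n\<close> stops just before the tail \<open>A n\<close>
    begins, and \<open>m\<close> lies below that tail.\<close>
  have m_meet: "m \<sqinter> F 0 n \<sqsubseteq> z" for n
  proof -
    have "F 0 n \<sqinter> A n \<sqsubseteq> z"
      by (rule aleph0_upper_continuous_chain[OF up _ _ A]) (use carr F_mono F_meet in auto)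
    moreover have "m \<sqinter> F 0 n \<sqsubseteq> F 0 n \<sqinter> A n"
      using mc carr Ac
      by (intro meet_le meet_right le_trans[OF meet_left m_le]) auto
    ultimately show ?thesis
      using mc carr Ac by (auto intro: le_trans[of "m \<sqinter> F 0 n"])
  qed
  have "m \<sqinter> A 0 \<sqsubseteq> z"
    by (rule aleph0_upper_continuous_chain[OF up _ _ A mc]) (use carr F_mono m_meet in auto)
  \<comment> \<open>Despite its name, \<open>le_iff_join\<close> characterizes the order by meets;
    with \<open>m \<sqsubseteq> A 0\<close> it gives \<open>m = m \<sqinter> A 0\<close>.\<close>
  then have "m \<sqsubseteq> z"
    using m_le mc carr Ac by (metis le_iff_join)
  then have "m \<sqsubseteq> c"
    by (rule le_trans[OF _ le_trans[OF z_le C_le]]) (use mc carr cc in auto)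
  have a_le_cA: "a \<sqsubseteq> c \<squnion> A n" for n
  proof -
    have "C n \<sqsubseteq> c \<squnion> A n"
      by (rule le_trans[OF C_le join_left]) (use cc Ac carr in auto)
    moreover have "F n 1 \<sqsubseteq> c \<squnion> A n"
      by (rule le_trans[OF F_le_A join_right]) (use cc Ac carr in auto)
    ultimately show ?thesis
      using cc Ac carr by (intro le_trans[OF a_le join_le]) auto
  qed
  \<comment> \<open>Lower continuity enters here: the fixed element is \<open>c\<close> and the
    decreasing chain is \<open>A\<close>.\<close>
  have "a \<sqsubseteq> c \<squnion> m"
    by (rule aleph0_lower_continuous_chain[OF low _ _ m cc]) (use Ac carr A_dec a_le_cA in auto)
  also have "c \<squnion> m \<sqsubseteq> c"
    using \<open>m \<sqsubseteq> c\<close> mc cc by (simp add: join_le)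
  finally have "a \<sqsubseteq> c"
    using mc cc carr by simp
  then have "a \<sqinter> c = a"
    using carr cc le_iff_join by simp
  moreover have "a \<sqinter> c \<sqsubseteq> z"
    by (rule aleph0_upper_continuous_chain[OF up _ _ c]) (use carr C_mono C_meet in auto)
  ultimately show ?thesis
    by simp
qed

end

section \<open>Flags of subspaces\<close>

context left_vector_space
begin

section \<open>Scalar arithmetic and one-dimensional subspaces\<close>

lemma smult_l_null: "x \<in> carrier V \<Longrightarrow> \<zero> \<odot>\<^bsub>V\<^esub> x = \<zero>\<^bsub>V\<^esub>"
  by (metis R.zero_closed R.l_zero V.add.l_cancel_one V.add.r_cancel_one smult_closed smult_l_distr)

lemma smult_r_null: "a \<in> carrier R \<Longrightarrow> a \<odot>\<^bsub>V\<^esub> \<zero>\<^bsub>V\<^esub> = \<zero>\<^bsub>V\<^esub>"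
  by (metis V.zero_closed V.l_zero V.add.r_cancel_one smult_closed smult_r_distr)

lemma smult_l_minus:
  "\<lbrakk>a \<in> carrier R; x \<in> carrier V\<rbrakk> \<Longrightarrow> (\<ominus> a) \<odot>\<^bsub>V\<^esub> x = \<ominus>\<^bsub>V\<^esub> (a \<odot>\<^bsub>V\<^esub> x)"
  by (metis R.add.inv_closed R.l_neg V.minus_equality smult_closed smult_l_distr smult_l_null)

text \<open>Division is what makes this work: a nonzero scalar is a unit, and multiplying by its
  inverse recovers \<open>x\<close> inside \<open>W\<close>.\<close>

lemma submodule_smult_cancel:
  assumes W: "submodule W R V" and a: "a \<in> carrier R" "a \<noteq> \<zero>"
    and x: "x \<in> carrier V" "a \<odot>\<^bsub>V\<^esub> x \<in> W"
  shows "x \<in> W"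
proof -
  have "a \<in> Units R"
    using a division_ring_Units by simp
  then have "inv a \<odot>\<^bsub>V\<^esub> (a \<odot>\<^bsub>V\<^esub> x) = x" "inv a \<in> carrier R"
    using a x by (simp_all add: smult_one flip: smult_assoc1)
  then show ?thesis
    using W x unfolding submodule_iff by metis
qed

definition line :: "'c \<Rightarrow> 'c set"
  where "line v = (\<lambda>a. a \<odot>\<^bsub>V\<^esub> v) ` carrier R"

lemma submodule_line:
  assumes "v \<in> carrier V"
  shows "submodule (line v) R V"
  unfolding submodule_iff
proof (intro conjI ballI)
  show "line v \<subseteq> carrier V"
    using assms by (auto simp: line_def smult_closed)
  show "\<zero>\<^bsub>V\<^esub> \<in> line v"
    unfolding line_def by (rule image_eqI[of _ _ \<zero>]) (use assms in \<open>simp_all add: smult_l_null\<close>)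
next
  fix x y assume "x \<in> line v" "y \<in> line v"
  then obtain a b where "a \<in> carrier R" "b \<in> carrier R" "x = a \<odot>\<^bsub>V\<^esub> v" "y = b \<odot>\<^bsub>V\<^esub> v"
    by (auto simp: line_def)
  then show "x \<oplus>\<^bsub>V\<^esub> y \<in> line v"
    unfolding line_def using assms by (intro image_eqI[of _ _ "a \<oplus> b"]) (simp_all add: smult_l_distr)
next
  fix x assume "x \<in> line v"
  then obtain a where a: "a \<in> carrier R" "x = a \<odot>\<^bsub>V\<^esub> v"
    by (auto simp: line_def)
  then show "\<ominus>\<^bsub>V\<^esub> x \<in> line v"
    unfolding line_def using assms by (intro image_eqI[of _ _ "\<ominus> a"]) (simp_all add: smult_l_minus)
  fix b assume "b \<in> carrier R"
  then show "b \<odot>\<^bsub>V\<^esub> x \<in> line v"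
    unfolding line_def using assms a by (intro image_eqI[of _ _ "b \<otimes> a"]) (simp_all add: smult_assoc1)
qed

lemma mem_line: "v \<in> carrier V \<Longrightarrow> v \<in> line v"
  unfolding line_def by (rule image_eqI[of _ _ \<one>]) (simp_all add: smult_one)

lemma line_subset: "submodule W R V \<Longrightarrow> v \<in> W \<Longrightarrow> line v \<subseteq> W"
  unfolding submodule_iff line_def by blast

lemma mem_subspace_add:
  "z \<in> A <+>\<^bsub>V\<^esub> B \<longleftrightarrow> (\<exists>x\<in>A. \<exists>y\<in>B. z = x \<oplus>\<^bsub>V\<^esub> y)"
  by (simp add: set_add_def')

lemma subspace_add_upper:
  assumes "submodule A R V" "submodule B R V"
  shows "A \<subseteq> A <+>\<^bsub>V\<^esub> B" "B \<subseteq> A <+>\<^bsub>V\<^esub> B"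
  using least_subspace_add[OF assms] assms
  by (auto simp: least_def Upper_def subspace_lattice_def)

lemma subspace_add_least:
  assumes "submodule W R V" "A \<subseteq> W" "B \<subseteq> W"
  shows "A <+>\<^bsub>V\<^esub> B \<subseteq> W"
  using assms unfolding submodule_iff mem_subspace_add subset_iff by metis

text \<open>If \<open>y \<oplus> a \<odot> g\<close> lies in \<open>A\<close> with \<open>y\<close>
  in \<open>B\<close>, then \<open>a \<odot> g\<close> is a difference of two vectors of
  \<open>D\<close>, so \<open>g \<notin> D\<close> forces \<open>a = \<zero>\<close>. This is the
  induction step of both trivial-intersection results below.\<close>

lemma subspace_Int_add_line:
  assumes sub: "submodule A R V" "submodule B R V" "submodule D R V"
    and le: "A \<subseteq> D" "B \<subseteq> D" and g: "g \<in> carrier V" "g \<notin> D"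
  shows "A \<inter> (B <+>\<^bsub>V\<^esub> line g) = A \<inter> B"
proof
  show "A \<inter> (B <+>\<^bsub>V\<^esub> line g) \<subseteq> A \<inter> B"
  proof
    fix x assume x: "x \<in> A \<inter> (B <+>\<^bsub>V\<^esub> line g)"
    then obtain y a where y: "y \<in> B" and a: "a \<in> carrier R" and xy: "x = y \<oplus>\<^bsub>V\<^esub> a \<odot>\<^bsub>V\<^esub> g"
      by (auto simp: mem_subspace_add line_def)
    have car: "y \<in> carrier V" "a \<odot>\<^bsub>V\<^esub> g \<in> carrier V"
      using y sub a g by (auto simp: submodule_iff smult_closed)
    have "\<ominus>\<^bsub>V\<^esub> y \<oplus>\<^bsub>V\<^esub> x \<in> D"
      using x y le sub(3) unfolding submodule_iff by blast
    moreover have "\<ominus>\<^bsub>V\<^esub> y \<oplus>\<^bsub>V\<^esub> x = a \<odot>\<^bsub>V\<^esub> g"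
      using car unfolding xy by (simp add: V.r_neg1)
    ultimately have "a = \<zero>"
      using submodule_smult_cancel[OF sub(3) a _ g(1)] g(2) by auto
    then have "x = y"
      using xy car g by (simp add: smult_l_null)
    then show "x \<in> A \<inter> B"
      using x y by simp
  qed
  show "A \<inter> B \<subseteq> A \<inter> (B <+>\<^bsub>V\<^esub> line g)"
    using subspace_add_upper(1)[OF sub(2) submodule_line[OF g(1)]] by blast
qed

section \<open>Spans of initial segments of a sequence\<close>

lemma submodule_zero: "submodule {\<zero>\<^bsub>V\<^esub>} R V"
  unfolding submodule_iff by (simp add: smult_r_null)

text \<open>The span of \<open>e 0\<close>, ..., \<open>e (n - 1)\<close>, built by adding one line
  at a time so that intersections can be treated by induction without finite sums. The sequence is a
  parameter because shifts and differences of \<open>e\<close> are used as well.\<close>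

primrec flag :: "(nat \<Rightarrow> 'c) \<Rightarrow> nat \<Rightarrow> 'c set"
  where
    "flag e 0 = {\<zero>\<^bsub>V\<^esub>}"
  | "flag e (Suc n) = flag e n <+>\<^bsub>V\<^esub> line (e n)"

lemma submodule_flag: "(\<And>i. i < n \<Longrightarrow> e i \<in> carrier V) \<Longrightarrow> submodule (flag e n) R V"
  by (induction n) (simp_all add: submodule_zero subspace_add submodule_line)

lemma flag_Suc_upper:
  assumes "\<And>i. i \<le> n \<Longrightarrow> e i \<in> carrier V"
  shows "flag e n \<subseteq> flag e (Suc n)" "e n \<in> flag e (Suc n)"
  using subspace_add_upper[of "flag e n" "line (e n)"] mem_line[of "e n"] assms
  by (auto simp: submodule_flag submodule_line)

text \<open>Together with \<open>mem_flag\<close> this is the universal property of the span,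
  through which flags of different sequences are compared.\<close>

lemma flag_subset:
  assumes "submodule W R V" "\<And>i. i < n \<Longrightarrow> e i \<in> W"
  shows "flag e n \<subseteq> W"
  using assms(2)
proof (induction n)
  case 0
  then show ?case using assms(1) by (simp add: submodule_iff)
next
  case (Suc n)
  then show ?case by (simp add: subspace_add_least line_subset assms(1))
qed

lemma mem_flag:
  assumes "\<And>i. i < n \<Longrightarrow> e i \<in> carrier V" "i < n"
  shows "e i \<in> flag e n"
  using assms
proof (induction n)
  case (Suc n)
  then show ?case
    using flag_Suc_upper[of n e] by (cases "i = n") (auto simp del: flag.simps)
qed simp

lemma flag_1:
  assumes "e 0 \<in> carrier V"
  shows "flag e 1 = line (e 0)"
proof -
  note line = submodule_line[OF assms]
  have "{\<zero>\<^bsub>V\<^esub>} \<subseteq> line (e 0)"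
    using line by (simp add: submodule_iff)
  then have "{\<zero>\<^bsub>V\<^esub>} <+>\<^bsub>V\<^esub> line (e 0) = line (e 0)"
    by (intro equalityI subspace_add_least subspace_add_upper(2) line submodule_zero order_refl)
  then show ?thesis
    by simp
qed

lemma flag_mono:
  assumes "\<And>i. i < n \<Longrightarrow> e i \<in> carrier V" "m \<le> n"
  shows "flag e m \<subseteq> flag e n"
  using assms by (intro flag_subset submodule_flag mem_flag) auto

end

section \<open>Bases from flags\<close>

context left_vector_space
begin

lemma finsum_smult_closed:
  "\<lbrakk>A \<subseteq> carrier V; c \<in> A \<rightarrow> carrier R\<rbrakk> \<Longrightarrow> finsum V (\<lambda>v. c v \<odot>\<^bsub>V\<^esub> v) A \<in> carrier V"
  by (intro V.finsum_closed) (auto intro!: smult_closed)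

lemma finsum_smult_insert:
  assumes "finite A" "v \<notin> A" "insert v A \<subseteq> carrier V" "c \<in> insert v A \<rightarrow> carrier R"
  shows "finsum V (\<lambda>v. c v \<odot>\<^bsub>V\<^esub> v) (insert v A) =
    finsum V (\<lambda>v. c v \<odot>\<^bsub>V\<^esub> v) A \<oplus>\<^bsub>V\<^esub> c v \<odot>\<^bsub>V\<^esub> v"
proof -
  have "finsum V (\<lambda>v. c v \<odot>\<^bsub>V\<^esub> v) (insert v A) =
      c v \<odot>\<^bsub>V\<^esub> v \<oplus>\<^bsub>V\<^esub> finsum V (\<lambda>v. c v \<odot>\<^bsub>V\<^esub> v) A"
    using assms by (intro V.finsum_insert) (auto intro!: smult_closed)
  then show ?thesis
    using assms by (simp add: V.a_comm finsum_smult_closed smult_closed Pi_iff)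
qed

lemma lin_span_empty: "lin_span R V {} = {\<zero>\<^bsub>V\<^esub>}"
  by (auto simp: lin_span_def)

lemma lin_span_insert:
  assumes B: "B \<subseteq> carrier V" and v: "v \<in> carrier V" "v \<notin> B"
  shows "lin_span R V (insert v B) = lin_span R V B <+>\<^bsub>V\<^esub> line v"
proof (intro equalityI subsetI)
  fix x assume "x \<in> lin_span R V (insert v B)"
  then obtain A c where A: "finite A" "A \<subseteq> insert v B" "c \<in> A \<rightarrow> carrier R"
    and x: "x = finsum V (\<lambda>v. c v \<odot>\<^bsub>V\<^esub> v) A"
    unfolding lin_span_def by blast
  define y where "y = finsum V (\<lambda>v. c v \<odot>\<^bsub>V\<^esub> v) (A - {v})"
  have "y \<in> lin_span R V B"
    unfolding lin_span_def y_def using A by blast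
  \<comment> \<open>A vector \<open>v\<close> that does not occur in the combination is given
    coefficient zero, which makes the two cases uniform.\<close>
  moreover have "x = y \<oplus>\<^bsub>V\<^esub> (if v \<in> A then c v else \<zero>) \<odot>\<^bsub>V\<^esub> v"
  proof (cases "v \<in> A")
    case True
    then have "A = insert v (A - {v})"
      by blast
    then show ?thesis
      using finsum_smult_insert[of "A - {v}" v c] A B v True unfolding x y_def
      by (auto simp: Pi_iff)
  next
    case False
    moreover from this have "A \<subseteq> carrier V"
      using A B by blast
    ultimately show ?thesis
      using A v finsum_smult_closed[of A c] unfolding x y_def
      by (simp add: smult_l_null)
  qed
  moreover have "(if v \<in> A then c v else \<zero>) \<in> carrier R"
    using A by auto
  ultimately show "x \<in> lin_span R V B <+>\<^bsub>V\<^esub> line v"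
    unfolding mem_subspace_add line_def by blast
next
  fix x assume "x \<in> lin_span R V B <+>\<^bsub>V\<^esub> line v"
  then obtain A c a where A: "finite A" "A \<subseteq> B" "c \<in> A \<rightarrow> carrier R" and a: "a \<in> carrier R"
    and x: "x = finsum V (\<lambda>v. c v \<odot>\<^bsub>V\<^esub> v) A \<oplus>\<^bsub>V\<^esub> a \<odot>\<^bsub>V\<^esub> v"
    unfolding mem_subspace_add line_def lin_span_def by blast
  \<comment> \<open>The value of \<open>c\<close> at \<open>v\<close> is arbitrary since
    \<open>v\<close> is outside \<open>A\<close>; overwriting it leaves the sum over
    \<open>A\<close> unchanged.\<close>
  let ?c = "c(v := a)"
  have "v \<notin> A" "A \<subseteq> carrier V"
    using A B v by auto
  moreover have "finsum V (\<lambda>w. ?c w \<odot>\<^bsub>V\<^esub> w) A = finsum V (\<lambda>w. c w \<odot>\<^bsub>V\<^esub> w) A"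
    using \<open>v \<notin> A\<close> \<open>A \<subseteq> carrier V\<close> A by (intro V.finsum_cong') (auto intro!: smult_closed)
  ultimately have "x = finsum V (\<lambda>w. ?c w \<odot>\<^bsub>V\<^esub> w) (insert v A)"
    using finsum_smult_insert[of A v ?c] A a v unfolding x by auto
  moreover have "?c \<in> insert v A \<rightarrow> carrier R"
    using A a by auto
  ultimately show "x \<in> lin_span R V (insert v B)"
    unfolding lin_span_def using A by blast
qed

text \<open>A relation with nonzero coefficient at \<open>v\<close> would put \<open>v\<close> into
  the span of \<open>B\<close>; once that coefficient vanishes, a relation within \<open>B\<close>
  remains. In the application the span is a flag, hence a submodule.\<close>

lemma lin_indep_insert:
  assumes B: "B \<subseteq> carrier V" "lin_indep R V B" "submodule (lin_span R V B) R V"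
    and v: "v \<in> carrier V" "v \<notin> lin_span R V B"
  shows "lin_indep R V (insert v B)"
  unfolding lin_indep_def
proof (intro allI impI, elim conjE)
  fix A c
  assume A: "finite A" "A \<subseteq> insert v B" "c \<in> A \<rightarrow> carrier R"
    and 0: "finsum V (\<lambda>v. c v \<odot>\<^bsub>V\<^esub> v) A = \<zero>\<^bsub>V\<^esub>"
  have indep: "\<forall>w\<in>A - {v}. c w = \<zero>" if "finsum V (\<lambda>v. c v \<odot>\<^bsub>V\<^esub> v) (A - {v}) = \<zero>\<^bsub>V\<^esub>"
    using B(2) A that unfolding lin_indep_def by blast
  show "\<forall>w\<in>A. c w = \<zero>"
  proof (cases "v \<in> A")
    case False
    then show ?thesis
      using indep 0 by simp
  next
    case True
    define y where "y = finsum V (\<lambda>v. c v \<odot>\<^bsub>V\<^esub> v) (A - {v})"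
    have y: "y \<in> lin_span R V B"
      unfolding lin_span_def y_def using A by blast
    have car: "y \<in> carrier V" "c v \<in> carrier R"
      using y B(3) A(3) True by (auto simp: submodule_iff)
    then have car': "c v \<odot>\<^bsub>V\<^esub> v \<in> carrier V"
      using v(1) by (simp add: smult_closed)
    have "insert v (A - {v}) = A" "A \<subseteq> carrier V"
      using True A(2) B(1) v(1) by blast+
    then have sum0: "y \<oplus>\<^bsub>V\<^esub> c v \<odot>\<^bsub>V\<^esub> v = \<zero>\<^bsub>V\<^esub>"
      using finsum_smult_insert[of "A - {v}" v c] A(1,3) 0 unfolding y_def by simp
    then have "c v \<odot>\<^bsub>V\<^esub> v = \<ominus>\<^bsub>V\<^esub> y"
      using car car' by (metis V.a_comm V.minus_equality)
    then have "c v \<odot>\<^bsub>V\<^esub> v \<in> lin_span R V B"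
      using y B(3) by (simp add: submodule_iff)
    then have cv: "c v = \<zero>"
      using submodule_smult_cancel[OF B(3) car(2) _ v(1)] v(2) by blast
    then have "y = \<zero>\<^bsub>V\<^esub>"
      using sum0 car v by (simp add: smult_l_null)
    then show ?thesis
      using indep cv unfolding y_def by blast
  qed
qed

text \<open>Links flags to the definition of dimension: by contraposition, in infinite dimension no
  finite stage of a sequence that keeps leaving its flags can exhaust the space.\<close>

lemma is_basis_flag:
  assumes "\<And>i. i < n \<Longrightarrow> e i \<in> carrier V" "\<And>i. i < n \<Longrightarrow> e i \<notin> flag e i"
    and "flag e n = carrier V"
  shows "is_basis R V (e ` {..<n})"
proof -
  \<comment> \<open>Independence and span are proved together, since extending the independent set
    needs its span to be the flag.\<close>
  have "lin_indep R V (e ` {..<n}) \<and> lin_span R V (e ` {..<n}) = flag e n"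
    using assms(1,2)
  proof (induction n)
    case 0
    then show ?case by (simp add: lin_span_empty) (simp add: lin_indep_def)
  next
    case (Suc n)
    then have IH: "lin_indep R V (e ` {..<n})" "lin_span R V (e ` {..<n}) = flag e n"
      by auto
    have sub: "e ` {..<n} \<subseteq> carrier V" and en: "e n \<in> carrier V" "e n \<notin> flag e n"
      using Suc.prems by auto
    have "e n \<notin> e ` {..<n}"
      using mem_flag[of n e] Suc.prems en(2) by (metis imageE lessThan_iff less_SucI)
    then show ?case
      using lin_indep_insert[OF sub IH(1) _ en(1)] lin_span_insert[OF sub en(1)] IH(2) en
        submodule_flag[of n e] Suc.prems by (simp add: lessThan_Suc)
  qed
  then show ?thesis
    using assms by (auto simp: is_basis_def)
qed

lemma infinite_dimensional_sequence:
  assumes "infinite_dimensional R V"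
  obtains e where "\<And>n. e n \<in> carrier V" "\<And>n. e n \<notin> flag e n"
proof -
  define pick where "pick W = (SOME v. v \<in> carrier V \<and> v \<notin> W)" for W
  \<comment> \<open>The recursion runs on subspaces, so each step depends only on the previous
    stage; the vectors are read off afterwards and \<open>flag_W\<close> identifies the stages as
    their flags.\<close>
  define W where "W n = ((\<lambda>W. W <+>\<^bsub>V\<^esub> line (pick W)) ^^ n) {\<zero>\<^bsub>V\<^esub>}" for n
  define e where "e n = pick (W n)" for n
  have flag_W: "flag e n = W n" for n
    by (induction n) (simp_all add: W_def e_def)
  have "e n \<in> carrier V \<and> e n \<notin> flag e n" for n
  \<comment> \<open>That \<open>pick\<close> succeeds at \<open>n\<close> relies on all earlier
    choices having succeeded, hence the strong induction.\<close>
  proof (induction n rule: less_induct)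
    case (less n)
    then have "flag e n \<noteq> carrier V"
      using is_basis_flag[of n e] assms unfolding infinite_dimensional_def by blast
    moreover have "flag e n \<subseteq> carrier V"
      using submodule_flag[of n e] less by (auto simp: submodule_iff)
    ultimately have "\<exists>v. v \<in> carrier V \<and> v \<notin> W n"
      unfolding flag_W by blast
    then show ?case
      unfolding flag_W unfolding e_def pick_def by (rule someI_ex)
  qed
  then show ?thesis
    using that by blast
qed

section \<open>Heads, tails and consecutive differences of the sequence\<close>

text \<open>Each new tail vector \<open>e (n + k)\<close> avoids \<open>flag e (n + k)\<close>,
  which contains both the head and the tail built so far.\<close>

lemma flag_Int_tail:
  assumes "\<And>n. e n \<in> carrier V" "\<And>n. e n \<notin> flag e n"
  shows "flag e n \<inter> flag (\<lambda>i. e (n + i)) k = {\<zero>\<^bsub>V\<^esub>}"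
proof (induction k)
  case 0
  then show ?case
    using submodule_flag[of n e] assms by (auto simp: submodule_iff)
next
  case (Suc k)
  have "flag e n \<inter> (flag (\<lambda>i. e (n + i)) k <+>\<^bsub>V\<^esub> line (e (n + k))) =
      flag e n \<inter> flag (\<lambda>i. e (n + i)) k"
    using assms
    by (intro subspace_Int_add_line[where D = "flag e (n + k)"] submodule_flag flag_mono
        flag_subset mem_flag) auto
  then show ?case
    using Suc by simp
qed

text \<open>The first \<open>n\<close> differences lie in the span of \<open>e 0\<close>, ...,
  \<open>e n\<close>, whereas the next one involves \<open>e (Suc n)\<close> and leaves that
  span.\<close>

lemma flag_Int_differences:
  assumes "\<And>n. e n \<in> carrier V" "\<And>n. e n \<notin> flag e n"
  shows "flag e 1 \<inter> flag (\<lambda>i. e i \<ominus>\<^bsub>V\<^esub> e (Suc i)) n = {\<zero>\<^bsub>V\<^esub>}"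
proof (induction n)
  case 0
  then show ?case
    using submodule_flag[of 1 e] assms by (auto simp: submodule_iff)
next
  case (Suc n)
  let ?d = "\<lambda>i. e i \<ominus>\<^bsub>V\<^esub> e (Suc i)"
  note sub = submodule_flag[of _ e, OF assms(1)]
  have diff: "x \<ominus>\<^bsub>V\<^esub> y \<in> W" if "submodule W R V" "x \<in> W" "y \<in> W" for W x y
    using that unfolding submodule_iff a_minus_def by blast
  have "?d n \<notin> flag e (Suc n)"
  proof
    assume "?d n \<in> flag e (Suc n)"
    then have "e n \<ominus>\<^bsub>V\<^esub> ?d n \<in> flag e (Suc n)"
      using diff[OF sub mem_flag[of "Suc n" e n]] assms(1) by blast
    also have "e n \<ominus>\<^bsub>V\<^esub> ?d n = e (Suc n)"
      using assms(1) by (simp add: a_minus_def V.minus_add V.r_neg2)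
    finally show False
      using assms(2) by blast
  qed
  moreover have "flag ?d n \<subseteq> flag e (Suc n)"
    using assms by (intro flag_subset diff sub mem_flag) auto
  ultimately have "flag e 1 \<inter> (flag ?d n <+>\<^bsub>V\<^esub> line (?d n)) = flag e 1 \<inter> flag ?d n"
    using assms
    by (intro subspace_Int_add_line[where D = "flag e (Suc n)"] sub submodule_flag flag_mono) auto
  then show ?case
    using Suc by simp
qed

text \<open>Telescoping: \<open>e 0\<close> is the sum of the first \<open>n\<close> differences and
  \<open>e n\<close>. The induction shows that the subspace for \<open>n\<close> is contained in the
  one for \<open>Suc n\<close>.\<close>

lemma mem_flag_differences_add:
  assumes "\<And>n. e n \<in> carrier V"
  shows "e 0 \<in> flag (\<lambda>i. e i \<ominus>\<^bsub>V\<^esub> e (Suc i)) n <+>\<^bsub>V\<^esub> line (e n)"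
proof (induction n)
  case 0
  then show ?case
    using subspace_add_upper(2)[OF submodule_zero submodule_line] mem_line assms by auto
next
  case (Suc n)
  let ?d = "\<lambda>i. e i \<ominus>\<^bsub>V\<^esub> e (Suc i)"
  let ?W = "flag ?d (Suc n) <+>\<^bsub>V\<^esub> line (e (Suc n))"
  have sub: "submodule (flag ?d (Suc n)) R V" "submodule (line (e (Suc n))) R V"
    using assms by (intro submodule_flag submodule_line; simp)+
  have W: "submodule ?W R V" and up: "flag ?d (Suc n) \<subseteq> ?W" "line (e (Suc n)) \<subseteq> ?W"
    using subspace_add subspace_add_upper sub by auto
  have "?d n \<in> ?W" "e (Suc n) \<in> ?W"
    using up flag_Suc_upper(2)[of n ?d] mem_line assms by auto
  then have "?d n \<oplus>\<^bsub>V\<^esub> e (Suc n) \<in> ?W"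
    using W by (simp add: submodule_iff)
  then have "e n \<in> ?W"
    using assms by (simp add: a_minus_def V.a_assoc V.l_neg)
  moreover have "flag ?d n \<subseteq> ?W"
    using up(1) flag_Suc_upper(1)[of n ?d] assms by auto
  ultimately have "flag ?d n <+>\<^bsub>V\<^esub> line (e n) \<subseteq> ?W"
    using W by (intro subspace_add_least line_subset) auto
  then show ?case
    using Suc by blast
qed

end


section \<open>Embeddings of subspace lattices\<close>

context left_vector_space
begin

text \<open>\<open>join\<close> picks some least upper bound, so uniqueness identifies it; this
  turns \<open>join_pres\<close> into a statement about sums of subspaces.\<close>

lemma join_subspace_lattice:
  assumes "submodule A R V" "submodule B R V"
  shows "A \<squnion>\<^bsub>subspace_lattice R V\<^esub> B = A <+>\<^bsub>V\<^esub> B"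
proof -
  interpret S: lattice "subspace_lattice R V"
    by (rule subspace_lattice)
  show ?thesis
    using S.least_unique[OF S.sup_of_two_least least_subspace_add] assms
    by (auto simp: join_def subspace_lattice_def)
qed

lemma meet_subspace_lattice:
  assumes "submodule A R V" "submodule B R V"
  shows "A \<sqinter>\<^bsub>subspace_lattice R V\<^esub> B = A \<inter> B"
proof -
  interpret S: lattice "subspace_lattice R V"
    by (rule subspace_lattice)
  show ?thesis
    using S.greatest_unique[OF S.inf_of_two_greatest greatest_subspace_Int] assms
    by (auto simp: meet_def subspace_lattice_def)
qed

end

theorem corollary12p4:
  fixes R :: "('a, 'r) ring_scheme"
    and V :: "('a, 'v, 'm) module_scheme"
    and L :: "('l, 'n) gorder_scheme"
  assumes "left_vector_space R V"
    and "infinite_dimensional R V"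
    and "lattice L"
    and "aleph0_complete L"
    and "aleph0_upper_continuous L"
    and "aleph0_lower_continuous L"
  shows "\<not> (\<exists>f. lattice_embedding (subspace_lattice R V) L f)"
proof
  interpret left_vector_space R V by fact
  interpret L: lattice L by fact
  let ?S = "subspace_lattice R V"
  assume "\<exists>f. lattice_embedding ?S L f"
  then obtain f where f: "f \<in> carrier ?S \<rightarrow> carrier L" "inj_on f (carrier ?S)"
      "join_pres ?S L f" "meet_pres ?S L f"
    unfolding lattice_embedding_def by blast
  have carrS: "A \<in> carrier ?S \<longleftrightarrow> submodule A R V" for A
    by (simp add: subspace_lattice_def)
  have f_carr: "f A \<in> carrier L" if "submodule A R V" for A
    using f(1) that carrS by blast
  have f_Int: "f (A \<inter> B) = f A \<sqinter>\<^bsub>L\<^esub> f B" and f_add: "f (A <+>\<^bsub>V\<^esub> B) = f A \<squnion>\<^bsub>L\<^esub> f B"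
    if "submodule A R V" "submodule B R V" for A B
    using f(3,4) that carrS meet_subspace_lattice join_subspace_lattice
    unfolding join_pres_def meet_pres_def by metis+
  have f_mono: "f A \<sqsubseteq>\<^bsub>L\<^esub> f B" if "submodule A R V" "submodule B R V" "A \<subseteq> B" for A B
    using use_iso2[OF join_pres_isotone[OF f(1,3)]] that
    by (simp add: subspace_lattice_def)
  obtain e where e: "\<And>n. e n \<in> carrier V" "\<And>n. e n \<notin> flag e n"
    using infinite_dimensional_sequence assms(2) by blast
  let ?d = "\<lambda>i. e i \<ominus>\<^bsub>V\<^esub> e (Suc i)"
  have sub: "submodule (flag e n) R V" "submodule (flag (\<lambda>i. e (n + i)) k) R V"
    "submodule (flag ?d n) R V" for n k
    using e(1) by (auto intro!: submodule_flag)
  have "f (flag e 1) \<sqsubseteq>\<^bsub>L\<^esub> f {\<zero>\<^bsub>V\<^esub>}"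
  proof (rule L.le_bottom_if_perspective_tails[where
        F = "\<lambda>n k. f (flag (\<lambda>i. e (n + i)) k)" and C = "\<lambda>n. f (flag ?d n)", OF assms(4-6)])
    fix n k
    show "f (flag (\<lambda>i. e (n + i)) k) \<sqsubseteq>\<^bsub>L\<^esub> f (flag (\<lambda>i. e (n + i)) (Suc k))"
      using e(1) by (intro f_mono sub flag_mono) auto
    \<comment> \<open>Counted from \<open>n\<close>, this vector has index \<open>Suc i\<close>,
      which accounts for the extra vector on the right.\<close>
    have "e (Suc n + i) \<in> flag (\<lambda>i. e (n + i)) (Suc k)" if "i < k" for i
      using mem_flag[of "Suc k" "\<lambda>i. e (n + i)" "Suc i"] e(1) that by simp
    then show "f (flag (\<lambda>i. e (Suc n + i)) k) \<sqsubseteq>\<^bsub>L\<^esub> f (flag (\<lambda>i. e (n + i)) (Suc k))"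
      by (intro f_mono sub flag_subset)
    show "f (flag (\<lambda>i. e (0 + i)) n) \<sqinter>\<^bsub>L\<^esub> f (flag (\<lambda>i. e (n + i)) k) \<sqsubseteq>\<^bsub>L\<^esub> f {\<zero>\<^bsub>V\<^esub>}"
      using flag_Int_tail[OF e, of n k] f_Int[OF sub(1,2), of n n k] f_carr[OF submodule_zero]
      by simp
    show "f (flag ?d n) \<sqsubseteq>\<^bsub>L\<^esub> f (flag ?d (Suc n))"
      using e(1) by (intro f_mono sub flag_mono) auto
    show "f (flag e 1) \<sqinter>\<^bsub>L\<^esub> f (flag ?d n) \<sqsubseteq>\<^bsub>L\<^esub> f {\<zero>\<^bsub>V\<^esub>}"
      using flag_Int_differences[OF e, of n] f_Int[OF sub(1,3), of 1 n] f_carr[OF submodule_zero]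
      by simp
    show "f {\<zero>\<^bsub>V\<^esub>} \<sqsubseteq>\<^bsub>L\<^esub> f (flag ?d n)"
      using f_mono[OF submodule_zero sub(3)] sub(3) by (auto simp: submodule_iff)
    \<comment> \<open>The telescoping sum handles the single generator \<open>e 0\<close>; by
      \<open>flag_1\<close>, the line of \<open>e n\<close> is the tail span with one
      vector.\<close>
    have "flag e 1 \<subseteq> flag ?d n <+>\<^bsub>V\<^esub> line (e n)"
      using mem_flag_differences_add[of e n] e(1)
      by (intro flag_subset subspace_add sub submodule_line) auto
    then show "f (flag e 1) \<sqsubseteq>\<^bsub>L\<^esub> f (flag ?d n) \<squnion>\<^bsub>L\<^esub> f (flag (\<lambda>i. e (n + i)) 1)"
      using flag_1[of "\<lambda>i. e (n + i)"] e(1)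
      by (subst f_add[symmetric]) (auto intro!: f_mono sub submodule_line subspace_add simp del: flag.simps)
  qed (intro f_carr sub submodule_zero)+
  moreover have "f {\<zero>\<^bsub>V\<^esub>} \<sqsubseteq>\<^bsub>L\<^esub> f (flag e 1)"
    using f_mono[OF submodule_zero sub(1)] sub(1) by (auto simp: submodule_iff simp del: flag.simps)
  ultimately have "f (flag e 1) = f {\<zero>\<^bsub>V\<^esub>}"
    using f_carr[OF sub(1)] f_carr[OF submodule_zero] by (rule L.le_antisym)
  \<comment> \<open>Injectivity of \<open>f\<close> collapses the line of \<open>e 0\<close>,
    contradicting \<open>e 0 \<notin> flag e 0\<close>, the zero subspace.\<close>
  then have "flag e 1 = {\<zero>\<^bsub>V\<^esub>}"
    by (rule inj_onD[OF f(2)]) (simp_all only: carrS sub(1) submodule_zero)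
  then show False
    using mem_flag[of 1 e 0] e(1) e(2)[of 0] by auto
qed

end
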